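(* Suppose $q(z)$ is a real monic polynomial of degree $p$. If $q(1)<0$, then $\rho(q(z))>1$. Otherwise, if $q(1)\ge0$, then $$\rho(q(z))\ge\left|\sqrt[p]{q(1)}-1\right|,$$ in which case equality holds if and only if $$q(z)=\left(z-\left(1-\sqrt[p]{q(1)}\right)\right)^p.$$
   Context: For a polynomial $q(z)$, $\rho(q(z))$ denotes its root radius, i.e. the maximum modulus over all complex roots of $q$. A real polynomial is one with real coefficients. $\sqrt[p]{\cdot}$ denotes the nonnegative real $p$-th root of a nonnegative real number.
   Formalization: The "only if" half of the equality case is claimed only when q(1)>0 or p=1, since it fails for q(1)=0, p≥2 (e.g. z^p−1 has root radius 1 but is not (z−1)^p); also p≥1 is assumed so that the root radius and p-th root make sense. *)

theory Defs
  imports "HOL-Computational_Algebra.Computational_Algebra"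
begin

(* Meaningful for degree q >= 1 only: the set of roots is then finite and nonempty. *)
definition root_radius :: "complex poly \<Rightarrow> real" where
  "root_radius q = Max (cmod ` {z. poly q z = 0})"

end

theory Submission
  imports Defs
begin

text \<open>
  Write \<open>q(1) = c ^ p\<close> and let \<open>x\<close> run over the complex roots of \<open>q\<close>, so that the product of the
  distances \<open>\<bar>1 - x\<bar>\<close> is \<open>c ^ p\<close>. If every root has modulus at most \<open>\<bar>1 - c\<bar>\<close>, the triangle inequality
  bounds all these distances by \<open>c\<close> on the same side (above if \<open>c \<ge> 1\<close>, below if \<open>c < 1\<close>), so for
  \<open>c > 0\<close> they all equal \<open>c\<close>, and the only point at distance \<open>c\<close> from \<open>1\<close> in the disc of radius
  \<open>\<bar>1 - c\<bar>\<close> is \<open>1 - c\<close>. This gives the inequality and the equality case at once.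
\<close>

lemma prod_mset_le_power_size:
  fixes f :: "'a \<Rightarrow> 'b::linordered_idom"
  assumes "\<And>x. x \<in># A \<Longrightarrow> 0 \<le> f x \<and> f x \<le> c"
  shows "0 \<le> (\<Prod>x\<in>#A. f x) \<and> (\<Prod>x\<in>#A. f x) \<le> c ^ size A"
  using assms
proof (induction A)
  case (add y A)
  from add.prems[of y] have "0 \<le> f y" "f y \<le> c" "0 \<le> c"
    by auto
  with add show ?case
    by (auto intro!: mult_mono)
qed simp

text \<open>Splitting off the factor at \<open>x\<close> leaves a product of at most
  \<open>c ^ size B\<close>. A value \<open>f x < c\<close> would thus make the whole product too
  small; \<open>c > 0\<close> allows the power to be cancelled.\<close>

lemma prod_mset_eq_power_size_imp_eq:
  fixes f :: "'a \<Rightarrow> 'b::linordered_idom"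
  assumes bound: "\<And>x. x \<in># A \<Longrightarrow> 0 \<le> f x \<and> f x \<le> c"
    and "c > 0" and prod: "(\<Prod>x\<in>#A. f x) = c ^ size A" and "x \<in># A"
  shows "f x = c"
proof -
  obtain B where B: "A = add_mset x B"
    using multi_member_split[OF \<open>x \<in># A\<close>] by blast
  have "(\<Prod>x\<in>#B. f x) \<le> c ^ size B"
    using prod_mset_le_power_size[of B f c] bound by (simp add: B)
  then have "f x * (\<Prod>x\<in>#B. f x) \<le> f x * c ^ size B"
    using bound[OF \<open>x \<in># A\<close>] by (simp add: mult_left_mono)
  with prod have "c * c ^ size B \<le> f x * c ^ size B"
    by (simp add: B)
  with \<open>c > 0\<close> have "c \<le> f x"
    by simp
  with bound[OF \<open>x \<in># A\<close>] show ?thesis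
    by simp
qed

lemma poly_map_poly_of_real:
  "poly (map_poly complex_of_real q) (of_real x) = of_real (poly q x)"
  by (induction q) (simp_all add: map_poly_pCons)

lemma map_poly_of_real_mult:
  "map_poly complex_of_real (p * q) = map_poly of_real p * map_poly of_real q"
  by (intro poly_eqI) (simp add: coeff_map_poly coeff_mult)

lemma map_poly_of_real_linear_power:
  "map_poly complex_of_real ([:a, 1:] ^ n) = [:of_real a, 1:] ^ n"
  by (induction n) (simp_all only: power.simps map_poly_of_real_mult, simp_all add: map_poly_pCons)

lemma map_poly_of_real_eq_iff:
  "map_poly complex_of_real p = map_poly complex_of_real q \<longleftrightarrow> p = q"
  by (auto simp: poly_eq_iff coeff_map_poly)

lemma norm_le_root_radius:
  assumes "q \<noteq> 0" "poly q z = 0"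
  shows "cmod z \<le> root_radius q"
  unfolding root_radius_def using assms poly_roots_finite[of q] by (intro Max_ge) auto

lemma root_radius_linear_power:
  assumes "n > 0"
  shows "root_radius ([:- a, 1:] ^ n) = cmod a"
proof -
  have "{z. poly ([:- a, 1:] ^ n) z = 0} = {a}"
    using assms by (auto simp: poly_power)
  then show ?thesis
    by (simp add: root_radius_def)
qed

lemma poly_eq_prod_roots_complex:
  fixes q :: "complex poly"
  assumes "lead_coeff q = 1"
  shows "poly q z = (\<Prod>x\<in>#proots q. z - x)"
proof -
  have "poly q z = poly (\<Prod>x\<in>#proots q. [:- x, 1:]) z"
    using complex_poly_decompose_multiset[of q] assms by simp
  then show ?thesis
    by (simp add: poly_prod_mset)
qed

text \<open>Every root in the factorization over the complex numbers may be replaced by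
  \<open>a\<close>, and there are \<open>degree q\<close> linear factors.\<close>

lemma complex_poly_eq_linear_power:
  fixes q :: "complex poly"
  assumes "lead_coeff q = 1" "\<And>x. poly q x = 0 \<Longrightarrow> x = a"
  shows "q = [:- a, 1:] ^ degree q"
proof -
  have "q \<noteq> 0"
    using assms(1) by auto
  have "q = (\<Prod>x\<in>#proots q. [:- x, 1:])"
    using complex_poly_decompose_multiset[of q] assms(1) by simp
  also have "\<dots> = (\<Prod>x\<in>#proots q. [:- a, 1:])"
    using assms(2) \<open>q \<noteq> 0\<close> by (intro arg_cong[where f = prod_mset] image_mset_cong) auto
  finally show ?thesis
    by (simp add: size_proots_complex)
qed

lemma prod_mset_inverse:
  fixes f :: "'a \<Rightarrow> 'b::field"
  shows "(\<Prod>x\<in>#A. inverse (f x)) = inverse (\<Prod>x\<in>#A. f x)"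
  by (induction A) simp_all

lemma norm_prod_mset:
  fixes f :: "'a \<Rightarrow> complex"
  shows "cmod (\<Prod>x\<in>#A. f x) = (\<Prod>x\<in>#A. cmod (f x))"
  by (induction A) (simp_all add: norm_mult)

text \<open>The circle of radius \<open>c\<close> around 1 and the disc of radius
  \<open>\<bar>1 - c\<bar>\<close> around 0 are tangent at \<open>1 - c\<close>. Comparing squared
  moduli gives \<open>Re z \<le> 1 - c\<close>, and \<open>Re (1 - z) \<le> c\<close> gives the
  converse; the circle equation then forces \<open>Im z = 0\<close>.\<close>

lemma complex_eq_of_real_if_norms:
  assumes "cmod z \<le> \<bar>1 - c\<bar>" "cmod (1 - z) = c"
  shows "z = of_real (1 - c)"
proof -
  have "(Re z)\<^sup>2 + (Im z)\<^sup>2 \<le> (1 - c)\<^sup>2"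
    using assms(1) by (metis cmod_power2 norm_ge_zero power2_abs power_mono)
  moreover have eq: "(1 - Re z)\<^sup>2 + (Im z)\<^sup>2 = c\<^sup>2"
    using assms(2) cmod_power2[of "1 - z"] by simp
  ultimately have "Re z \<le> 1 - c"
    by (simp add: power2_eq_square algebra_simps)
  moreover have "1 - Re z \<le> c"
    using complex_Re_le_cmod[of "1 - z"] assms(2) by simp
  ultimately have "Re z = 1 - c"
    by simp
  with eq show ?thesis
    by (simp add: complex_eq_iff)
qed

lemma roots_eq_if_cmod_le:
  fixes q :: "complex poly"
  assumes monic: "lead_coeff q = 1" and "c > 0" and q1: "cmod (poly q 1) = c ^ degree q"
    and le: "\<And>z. poly q z = 0 \<Longrightarrow> cmod z \<le> \<bar>1 - c\<bar>"
    and z: "poly q z = 0"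
  shows "z = of_real (1 - c)"
proof -
  have "q \<noteq> 0"
    using monic by auto
  then have roots: "x \<in># proots q \<longleftrightarrow> poly q x = 0" for x
    by simp
  have prod: "(\<Prod>x\<in>#proots q. cmod (1 - x)) = c ^ size (proots q)"
    using q1 by (simp add: poly_eq_prod_roots_complex[OF monic] norm_prod_mset size_proots_complex)
  have "cmod (1 - z) = c"
  proof (cases "c \<ge> 1")
    case True
    have "cmod (1 - x) \<le> c" if "poly q x = 0" for x
      using norm_triangle_ineq4[of 1 x] le[OF that] True by simp
    then show ?thesis
      using prod_mset_eq_power_size_imp_eq[of "proots q" "\<lambda>x. cmod (1 - x)" c z] prod \<open>c > 0\<close> z
      by (simp add: roots)
  next
    case False
    \<comment> \<open>Here the distances are bounded below, by \<open>1 - (1 - c) = c\<close>.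
      Passing to inverses turns this into the upper bound that the product argument
      requires.\<close>
    have "inverse (cmod (1 - x)) \<le> inverse c" if "poly q x = 0" for x
      using norm_triangle_ineq2[of 1 x] le[OF that] False \<open>c > 0\<close> by (intro le_imp_inverse_le) auto
    moreover have "(\<Prod>x\<in>#proots q. inverse (cmod (1 - x))) = inverse c ^ size (proots q)"
      using prod by (simp add: prod_mset_inverse power_inverse)
    ultimately have "inverse (cmod (1 - z)) = inverse c"
      using prod_mset_eq_power_size_imp_eq
        [of "proots q" "\<lambda>x. inverse (cmod (1 - x))" "inverse c" z] \<open>c > 0\<close> z
      by (simp add: roots)
    then show ?thesis
      by simp
  qed
  with le[OF z] show ?thesis
    by (rule complex_eq_of_real_if_norms)
qed

text \<open>With \<open>\<le>\<close> in place of equality this serves both claims: a smaller radius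
  would force a power whose radius is exactly \<open>\<bar>1 - c\<bar>\<close>.\<close>

lemma eq_linear_power_if_root_radius_le:
  fixes q :: "complex poly"
  assumes "lead_coeff q = 1" "c > 0" "cmod (poly q 1) = c ^ degree q"
    and "root_radius q \<le> \<bar>1 - c\<bar>"
  shows "q = [:- of_real (1 - c), 1:] ^ degree q"
proof (rule complex_poly_eq_linear_power[OF assms(1)])
  fix x assume "poly q x = 0"
  moreover have "cmod z \<le> \<bar>1 - c\<bar>" if "poly q z = 0" for z
    using norm_le_root_radius[OF _ that] assms by fastforce
  ultimately show "x = of_real (1 - c)"
    using assms by (intro roots_eq_if_cmod_le[of q])
qed

text \<open>A monic polynomial that is negative at 1 is eventually positive, so it has a real root
  beyond 1.\<close>

lemma root_radius_gt_1:
  fixes q :: "real poly"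
  assumes "lead_coeff q = 1" "poly q 1 < 0"
  shows "root_radius (map_poly complex_of_real q) > 1"
proof -
  obtain n where n: "\<And>x. x \<ge> n \<Longrightarrow> poly q x \<ge> 1"
    using poly_pinfty_gt_lc[of q] assms(1) by auto
  \<comment> \<open>The maximum with 2 keeps the right endpoint beyond 1.\<close>
  have "poly q (max n 2) > 0"
    using n[of "max n 2"] by simp
  then obtain x where "x > 1" "poly q x = 0"
    using poly_IVT_pos[of 1 "max n 2" q] assms(2) by (auto simp: less_max_iff_disj)
  then show ?thesis
    using norm_le_root_radius[of "map_poly complex_of_real q" "of_real x"] assms
    by (cases "q = 0") (auto simp: poly_map_poly_of_real map_poly_eq_0_iff)
qed

text \<open>For \<open>q(1) = 0\<close> and \<open>p \<ge> 2\<close> equality does not determine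
  \<open>q\<close>: \<open>z^(p-1) * (z - 1)\<close> has root radius 1, as does
  \<open>(z - 1)^p\<close>. Hence the equivalence is claimed for \<open>q(1) > 0\<close> or
  \<open>p = 1\<close>, and only one direction otherwise.\<close>

theorem lemma6:
  fixes q :: "real poly" and p :: nat
  assumes "lead_coeff q = 1" and "degree q = p" and "p \<ge> 1"
  shows "(poly q 1 < 0 \<longrightarrow> root_radius (map_poly complex_of_real q) > 1) \<and>
    (poly q 1 \<ge> 0 \<longrightarrow>
       root_radius (map_poly complex_of_real q) \<ge> \<bar>root p (poly q 1) - 1\<bar> \<and>
       (poly q 1 > 0 \<or> p = 1 \<longrightarrow>
          (root_radius (map_poly complex_of_real q) = \<bar>root p (poly q 1) - 1\<bar> \<longleftrightarrow>
           q = [:- (1 - root p (poly q 1)), 1:] ^ p)) \<and>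
       (q = [:- (1 - root p (poly q 1)), 1:] ^ p \<longrightarrow>
          root_radius (map_poly complex_of_real q) = \<bar>root p (poly q 1) - 1\<bar>))"
proof -
  define Q where "Q = map_poly complex_of_real q"
  define c where "c = root p (poly q 1)"
  define L where "L = [:- (1 - c), 1:] ^ p"
  have Q: "lead_coeff Q = 1" "degree Q = p" "Q \<noteq> 0"
    using assms by (auto simp: Q_def coeff_map_poly degree_map_poly map_poly_eq_0_iff)
  have Q_root: "cmod z \<le> root_radius Q" if "poly Q z = 0" for z
    using norm_le_root_radius[OF Q(3) that] .
  have Q1: "poly Q 1 = of_real (poly q 1)"
    using poly_map_poly_of_real[of q 1] by (simp add: Q_def)
  have map_L: "map_poly complex_of_real L = [:- of_real (1 - c), 1:] ^ p"
    using map_poly_of_real_linear_power[of "- (1 - c)" p] by (simp add: L_def)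
  have Q_eq: "Q = [:- of_real (1 - c), 1:] ^ p \<longleftrightarrow> q = L"
    using map_poly_of_real_eq_iff[of q L] by (simp add: Q_def map_L)
  have L_radius: "root_radius Q = \<bar>c - 1\<bar>" if "q = L"
  proof -
    have "root_radius Q = cmod (of_real (1 - c))"
      using that Q_eq root_radius_linear_power[of p "of_real (1 - c)"] assms(3) by simp
    then show ?thesis
      by (simp only: norm_of_real abs_minus_commute)
  qed
  have le_imp: "q = L" if "poly q 1 > 0" "root_radius Q \<le> \<bar>c - 1\<bar>"
  proof -
    have "c > 0" "c ^ p = poly q 1"
      using that(1) assms(3) by (simp_all add: c_def)
    with that Q show ?thesis
      using eq_linear_power_if_root_radius_le[of Q c] Q_eq by (simp add: Q1 abs_minus_commute)
  qed
  \<comment> \<open>Here \<open>c = 0\<close> and 1 is itself a root.\<close>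
  have zero: "\<bar>c - 1\<bar> \<le> root_radius Q" if "poly q 1 = 0"
    using Q_root[of 1] that by (simp add: Q1 c_def)
  \<comment> \<open>With \<open>q = z + a\<close> one has \<open>c = q(1) = 1 + a\<close>, whatever
    its sign.\<close>
  have linear: "q = L" if "p = 1"
  proof -
    have "degree q = 1" "coeff q 1 = 1"
      using assms that by auto
    moreover obtain a r where q: "q = pCons a r"
      by (cases q)
    ultimately have "degree r = 0" "coeff r 0 = 1"
      by (auto split: if_splits)
    then have "r = [:1:]"
      by (metis degree_0_id)
    with q that show ?thesis
      by (simp add: L_def c_def)
  qed
  \<comment> \<open>For \<open>q(1) > 0\<close>, a radius below \<open>\<bar>c - 1\<bar>\<close>
    would give \<open>q = L\<close>, whose radius is not below it.\<close>
  have "\<bar>c - 1\<bar> \<le> root_radius Q" if "poly q 1 \<ge> 0"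
    using that le_imp L_radius zero by fastforce
  moreover have "root_radius Q = \<bar>c - 1\<bar> \<longleftrightarrow> q = L" if "poly q 1 > 0 \<or> p = 1"
    using that le_imp L_radius linear by auto
  ultimately show ?thesis
    using root_radius_gt_1[OF assms(1)] L_radius unfolding Q_def c_def L_def by blast
qed

end
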